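(* Let $\mathcal B_n(p,q,t)$, $n\ge 0$, be the polynomials in $p,q,t$ defined as the Taylor coefficients in $z$ of the continued fraction $$\sum_{n=0}^{\infty}\mathcal B_n(p,q,t)z^{n}=\cfrac{1}{1-(1+t)z-\cfrac{(p+q)tz^2}{1-p(1+t)z-\cfrac{p^3tz^2}{1-p^2(1+t)z-\cfrac{p^5tz^2}{\ddots}}}}$$ (the coefficient of $z$ at level $h\ge 0$ is $p^h(1+t)$; the first partial numerator is $(p+q)tz^2$ and the $h$-th one, $h\ge2$, is $p^{2h-1}tz^2$). Then for every $n$, $$\mathcal B_n(p,q,t)=\sum_{\sigma\in\mathfrak S_{n+1}(3124,4123,3142,4132)}p^{(2\text{-}13)\,\sigma}\,q^{(31\text{-}2)\,\sigma}\,t^{\mathrm{des}\,\sigma}.$$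
   Context: $\mathfrak S_m$ is the set of permutations $\sigma=\sigma(1)\cdots\sigma(m)$ of $\{1,\dots,m\}$, and $\mathfrak S_m(3124,4123,3142,4132)$ is the subset of permutations avoiding all four of these classical patterns (no subsequence of $\sigma$, at not necessarily adjacent positions, is order-isomorphic to any of them). $\mathrm{des}\,\sigma$ is the number of $i$ with $1\le i<m$ and $\sigma(i)>\sigma(i+1)$. For $\sigma\in\mathfrak S_m$ define $$(31\text{-}2)\,\sigma=\sum_{i=1}^m\#\{j:1<j<i,\ \sigma(j)<\sigma(i)<\sigma(j-1)\},$$ $$(2\text{-}13)\,\sigma=\sum_{i=1}^m\#\{j: i<j<m,\ \sigma(j)<\sigma(i)<\sigma(j+1)\}.$$ Continued fractions are understood as formal power series in $z$. *)

theory Defs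
  imports
    "HOL-Combinatorics.Permutations"
    "HOL-Computational_Algebra.Formal_Power_Series"
begin

unbundle fps_syntax

section \<open>Permutation statistics and pattern avoidance\<close>

text \<open>A permutation of \<open>{1..m}\<close> is a function \<open>\<sigma>\<close> with \<open>\<sigma> permutes {1..m}\<close>;
  its one-line notation is \<open>\<sigma> 1 \<dots> \<sigma> m\<close>. A pattern is given by its list of letters.\<close>

definition contains_pattern :: "nat \<Rightarrow> (nat \<Rightarrow> nat) \<Rightarrow> nat list \<Rightarrow> bool" where
  "contains_pattern m \<sigma> \<pi> \<longleftrightarrow>
     (\<exists>pos. strict_mono_on {..<length \<pi>} pos \<and> pos ` {..<length \<pi>} \<subseteq> {1..m} \<and>
        (\<forall>a<length \<pi>. \<forall>b<length \<pi>. \<sigma> (pos a) < \<sigma> (pos b) \<longleftrightarrow> \<pi> ! a < \<pi> ! b))"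

definition avoiders :: "nat \<Rightarrow> nat list set \<Rightarrow> (nat \<Rightarrow> nat) set" where
  "avoiders m P = {\<sigma>. \<sigma> permutes {1..m} \<and> (\<forall>\<pi>\<in>P. \<not> contains_pattern m \<sigma> \<pi>)}"

definition des :: "nat \<Rightarrow> (nat \<Rightarrow> nat) \<Rightarrow> nat" where
  "des m \<sigma> = card {i. 1 \<le> i \<and> i < m \<and> \<sigma> i > \<sigma> (i + 1)}"

definition stat_31_2 :: "nat \<Rightarrow> (nat \<Rightarrow> nat) \<Rightarrow> nat" where
  "stat_31_2 m \<sigma> = (\<Sum>i=1..m. card {j. 1 < j \<and> j < i \<and> \<sigma> j < \<sigma> i \<and> \<sigma> i < \<sigma> (j - 1)})"

definition stat_2_13 :: "nat \<Rightarrow> (nat \<Rightarrow> nat) \<Rightarrow> nat" where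
  "stat_2_13 m \<sigma> = (\<Sum>i=1..m. card {j. i < j \<and> j < m \<and> \<sigma> j < \<sigma> i \<and> \<sigma> i < \<sigma> (j + 1)})"

section \<open>Continued fractions of Jacobi type\<close>

text \<open>\<open>jfrac_convergent b l N h\<close> is the finite continued fraction with \<open>N\<close> levels
  that starts at level \<open>h\<close>:
  \[ \frac{1}{1 - b_h z - \frac{l_{h+1} z^2}{1 - b_{h+1} z - \cdots
       \frac{l_{h+N-1} z^2}{1 - b_{h+N-1} z}}} \]
  The coefficient ring need not be a field, hence \<^const>\<open>fps_right_inverse\<close>; its second
  argument is the inverse of the constant coefficient, which is \<open>1\<close> here
  (see \<open>jfrac_convergent_Suc_mult\<close> below).\<close>

primrec jfrac_convergent ::
    "(nat \<Rightarrow> 'a::comm_ring_1) \<Rightarrow> (nat \<Rightarrow> 'a) \<Rightarrow> nat \<Rightarrow> nat \<Rightarrow> 'a fps" where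
  "jfrac_convergent b l 0 h = 0"
| "jfrac_convergent b l (Suc N) h =
     fps_right_inverse
       (1 - fps_const (b h) * fps_X
          - fps_const (l (Suc h)) * fps_X\<^sup>2 * jfrac_convergent b l N (Suc h)) 1"

text \<open>The infinite continued fraction is the limit of its convergents in the usual
  (\<open>z\<close>-adic) topology on formal power series.\<close>

definition jfrac :: "(nat \<Rightarrow> 'a::comm_ring_1) \<Rightarrow> (nat \<Rightarrow> 'a) \<Rightarrow> 'a fps" where
  "jfrac b l = lim (\<lambda>N. jfrac_convergent b l N 0)"

lemma jfrac_convergent_Suc_mult:
  "(1 - fps_const (b h) * fps_X
      - fps_const (l (Suc h)) * fps_X\<^sup>2 * jfrac_convergent b l N (Suc h))
     * jfrac_convergent b l (Suc N) h = 1"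
  unfolding jfrac_convergent.simps
  by (rule fps_right_inverse) (simp add: fps_mult_nth power2_eq_square mult.assoc)

lemma jfrac_convergent_diff:
  "fps_X ^ (2 * N) dvd jfrac_convergent b l (Suc N) h - jfrac_convergent b l N h"
proof (induction N arbitrary: h)
  case (Suc N)
  let ?G = "jfrac_convergent b l"
  define c where "c = fps_const (l (Suc h)) * fps_X\<^sup>2"
  define d where "d = 1 - fps_const (b h) * fps_X"
  define F F' G G' where "F = ?G (Suc (Suc N)) h" "F' = ?G (Suc N) h"
    "G = ?G (Suc N) (Suc h)" "G' = ?G N (Suc h)"
  have 1: "(d - c * G) * F = 1" "(d - c * G') * F' = 1"
    using jfrac_convergent_Suc_mult[of b h l "Suc N"] jfrac_convergent_Suc_mult[of b h l N]
    unfolding c_def d_def F_F'_G_G'_def by auto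
  have "F - F' = ((d - c * G') * F') * F - ((d - c * G) * F) * F'"
    unfolding 1 by simp
  also have "\<dots> = c * (G - G') * F * F'"
    by (simp add: algebra_simps)
  finally have eq: "F - F' = fps_X ^ 2 * (G - G') * (fps_const (l (Suc h)) * F * F')"
    unfolding c_def by (simp only: mult_ac)
  have "fps_X ^ (2 * N) dvd G - G'"
    unfolding F_F'_G_G'_def by (rule Suc.IH)
  hence "fps_X ^ 2 * fps_X ^ (2 * N) dvd F - F'"
    unfolding eq by (intro dvd_mult2 mult_dvd_mono) auto
  thus ?case
    unfolding F_F'_G_G'_def by (simp add: power_add[symmetric] del: jfrac_convergent.simps)
qed simp

lemma jfrac_convergent_nth_stable:
  assumes "N > n"
  shows "jfrac_convergent b l N h $ n = jfrac_convergent b l (Suc n) h $ n"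
proof -
  have "Suc n \<le> N" using assms by simp
  thus ?thesis
  proof (induction rule: dec_induct)
    case (step N)
    obtain k where "jfrac_convergent b l (Suc N) h - jfrac_convergent b l N h
        = fps_X ^ (2 * N) * k"
      using jfrac_convergent_diff[of N b l h] unfolding dvd_def by blast
    hence "(jfrac_convergent b l (Suc N) h - jfrac_convergent b l N h) $ n = 0"
      using step by (simp add: fps_X_power_mult_nth del: jfrac_convergent.simps)
    thus ?case using step by (simp del: jfrac_convergent.simps)
  qed simp
qed

lemma jfrac_convergent_tendsto:
  "(\<lambda>N. jfrac_convergent b l N h) \<longlonglongrightarrow>
     Abs_fps (\<lambda>n. jfrac_convergent b l (Suc n) h $ n)"
  unfolding tendsto_fps_iff fps_nth_Abs_fps
proof
  fix n
  show "\<forall>\<^sub>F N in sequentially. jfrac_convergent b l N h $ n = jfrac_convergent b l (Suc n) h $ n"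
    using eventually_gt_at_top[of n]
    by eventually_elim (rule jfrac_convergent_nth_stable)
qed

lemma jfrac_LIMSEQ: "(\<lambda>N. jfrac_convergent b l N 0) \<longlonglongrightarrow> jfrac b l"
  unfolding jfrac_def
  using jfrac_convergent_tendsto convergent_LIMSEQ_iff convergentI by blast

section \<open>The polynomials\<close>

text \<open>\<open>p\<close>, \<open>q\<close>, \<open>t\<close> range over an arbitrary commutative ring. The polynomials themselves
  are obtained for the indeterminates of a polynomial ring over the integers, such as
  \<open>int poly poly poly\<close>; in general \<open>B_poly n p q t\<close> is their value at \<open>(p, q, t)\<close>.\<close>

definition B_poly :: "nat \<Rightarrow> 'a::comm_ring_1 \<Rightarrow> 'a \<Rightarrow> 'a \<Rightarrow> 'a" where
  "B_poly n p q t =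
     jfrac (\<lambda>h. p ^ h * (1 + t))
           (\<lambda>h. if h = 1 then (p + q) * t else p ^ (2 * h - 1) * t) $ n"

end

theory Submission
  imports Defs
begin

text \<open>Insert the letters \<open>m, m - 1, \<dots>, 1\<close> one after the other. The letters present at a given
  time form \<open>h + 1\<close> maximal blocks of the final word, and the letter \<open>v\<close> either forms a new block,
  extends a block to the left or to the right, or merges two neighbouring blocks; the height \<open>h\<close>
  thus traces a Motzkin path (Francon and Viennot). The blocks that do not touch \<open>v\<close> are counted
  by the occurrences of 31-2 (those to the left) and of 2-13 (those to the right) in which \<open>v\<close>
  plays the role of 2. Avoiding the four patterns means that \<open>v\<close> is always inserted in the
  leftmost possible place, except that a second block may also be opened to the right of the
  first one. Hence each step has a single monomial weight, apart from the step from height 0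
  to height 1 with its weight \<open>p + q\<close>, and the paths are counted by the continued fraction.\<close>

section \<open>Continued fractions and Motzkin paths\<close>

text \<open>The continued fraction from level \<open>h\<close> on. Coefficient \<open>n\<close> no
  longer changes once a convergent has \<open>n + 1\<close> levels, so it is read off there.\<close>

definition jfrac_tail :: "(nat \<Rightarrow> 'a::comm_ring_1) \<Rightarrow> (nat \<Rightarrow> 'a) \<Rightarrow> nat \<Rightarrow> 'a fps" where
  "jfrac_tail b l h = Abs_fps (\<lambda>n. jfrac_convergent b l (Suc n) h $ n)"

lemma jfrac_eq_tail: "jfrac b l = jfrac_tail b l 0"
  using LIMSEQ_unique[OF jfrac_LIMSEQ jfrac_convergent_tendsto] by (simp add: jfrac_tail_def)

lemma jfrac_tail_nth:
  assumes "n < N"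
  shows "jfrac_tail b l h $ n = jfrac_convergent b l N h $ n"
  unfolding jfrac_tail_def using jfrac_convergent_nth_stable[OF assms, of b l h] by simp

lemma fps_mult_nth_cong:
  assumes "\<And>i. i \<le> n \<Longrightarrow> f $ i = f' $ i" "\<And>i. i \<le> n \<Longrightarrow> g $ i = g' $ i"
  shows "(f * g) $ n = (f' * g') $ n"
  unfolding fps_mult_nth by (rule sum.cong) (auto simp: assms)

text \<open>This is F = 1/(1 - b z - l z^2 G) with the denominator cleared. The convergents satisfy
  it, and it passes to the limit because coefficient \<open>n\<close> of a product involves only
  coefficients up to \<open>n\<close>.\<close>

lemma jfrac_tail_unfold:
  "jfrac_tail b l h = 1 + fps_const (b h) * fps_X * jfrac_tail b l h
     + fps_const (l (Suc h)) * fps_X\<^sup>2 * jfrac_tail b l (Suc h) * jfrac_tail b l h"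
  (is "_ = 1 + ?b * ?F + ?c * ?G * ?F")
proof (rule fps_ext)
  fix n
  let ?F' = "jfrac_convergent b l (Suc (Suc n)) h" and ?G' = "jfrac_convergent b l (Suc n) (Suc h)"
  have F: "?F $ i = ?F' $ i" and G: "?G $ i = ?G' $ i" if "i \<le> n" for i
    using that by (intro jfrac_tail_nth; simp)+
  have "?F' = 1 + ?b * ?F' + ?c * ?G' * ?F'"
    using jfrac_convergent_Suc_mult[of b h l "Suc n"]
    by (simp add: algebra_simps del: jfrac_convergent.simps)
  hence "?F' $ n = (1 + ?b * ?F' + ?c * ?G' * ?F') $ n"
    by (rule arg_cong)
  moreover have "(?b * ?F) $ n = (?b * ?F') $ n"
    by (rule fps_mult_nth_cong) (simp_all only: F)
  moreover have "(?c * ?G * ?F) $ n = (?c * ?G' * ?F') $ n"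
    by (intro fps_mult_nth_cong) (simp_all only: F G)
  ultimately show "?F $ n = (1 + ?b * ?F + ?c * ?G * ?F) $ n"
    by (simp only: F fps_add_nth order_refl)
qed

text \<open>Weighted Motzkin paths with \<open>n\<close> steps from height \<open>h\<close> to height 0.\<close>

primrec motzkin :: "(nat \<Rightarrow> 'a::comm_ring_1) \<Rightarrow> (nat \<Rightarrow> 'a) \<Rightarrow> (nat \<Rightarrow> 'a) \<Rightarrow> nat \<Rightarrow> nat \<Rightarrow> 'a" where
  "motzkin u b d 0 h = (if h = 0 then 1 else 0)"
| "motzkin u b d (Suc n) h = u h * motzkin u b d n (Suc h) + b h * motzkin u b d n h
     + (if h = 0 then 0 else d h * motzkin u b d n (h - 1))"

text \<open>The paths from \<open>h\<close> to 0, decomposed at their first visits of the heights \<open>h - 1, \<dots>, 0\<close>.\<close>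

primrec motzkin_fps :: "(nat \<Rightarrow> 'a::comm_ring_1) \<Rightarrow> (nat \<Rightarrow> 'a) \<Rightarrow> (nat \<Rightarrow> 'a) \<Rightarrow> nat \<Rightarrow> 'a fps" where
  "motzkin_fps b l d 0 = jfrac_tail b l 0"
| "motzkin_fps b l d (Suc h) =
     fps_const (d (Suc h)) * fps_X * motzkin_fps b l d h * jfrac_tail b l (Suc h)"

text \<open>Splits off the first step of a path. The assumption on \<open>l\<close> distributes each
  partial numerator over an up step and the down step that returns from it.\<close>

lemma motzkin_fps_unfold:
  assumes l: "\<And>h. l (Suc h) = u h * d (Suc h)"
  shows "motzkin_fps b l d h = (if h = 0 then 1 else 0) + fps_X *
    (fps_const (u h) * motzkin_fps b l d (Suc h) + fps_const (b h) * motzkin_fps b l d h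
      + (if h = 0 then 0 else fps_const (d h) * motzkin_fps b l d (h - 1)))"
    (is "_ = ?rhs")
proof (cases h)
  case 0
  have "?rhs = 1 + fps_const (b 0) * fps_X * jfrac_tail b l 0
     + fps_const (l (Suc 0)) * fps_X\<^sup>2 * jfrac_tail b l (Suc 0) * jfrac_tail b l 0"
    by (simp add: 0 l algebra_simps power2_eq_square flip: fps_const_mult)
  also have "\<dots> = motzkin_fps b l d h"
    unfolding 0 motzkin_fps.simps by (rule jfrac_tail_unfold[symmetric])
  finally show ?thesis by (rule sym)
next
  case (Suc g)
  \<comment> \<open>The factor shared by all terms: the step that first reaches \<open>g\<close>,
    and the path after it.\<close>
  define c where "c = fps_const (d (Suc g)) * fps_X * motzkin_fps b l d g"
  have "?rhs = c * (1 + fps_const (b h) * fps_X * jfrac_tail b l h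
     + fps_const (l (Suc h)) * fps_X\<^sup>2 * jfrac_tail b l (Suc h) * jfrac_tail b l h)"
    by (simp add: Suc c_def l algebra_simps power2_eq_square flip: fps_const_mult)
  also have "\<dots> = c * jfrac_tail b l h"
    by (rule arg_cong[OF jfrac_tail_unfold[symmetric]])
  also have "\<dots> = motzkin_fps b l d h"
    by (simp add: Suc c_def)
  finally show ?thesis by (rule sym)
qed

lemma motzkin_fps_nth:
  assumes "\<And>h. l (Suc h) = u h * d (Suc h)"
  shows "motzkin_fps b l d h $ n = motzkin u b d n h"
proof (induction n arbitrary: h)
  case 0
  show ?case
    by (subst motzkin_fps_unfold[where u = u]) (simp_all add: assms)
next
  case (Suc n)
  show ?case
    by (subst motzkin_fps_unfold[where u = u]) (simp_all add: assms Suc del: motzkin_fps.simps)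
qed

lemma jfrac_nth_eq_motzkin:
  assumes "\<And>h. l (Suc h) = u h * d (Suc h)"
  shows "jfrac b l $ n = motzkin u b d n 0"
  using motzkin_fps_nth[of l u d b 0 n] assms by (simp add: jfrac_eq_tail)

section \<open>Words with separators\<close>

text \<open>A list of blocks is encoded as a word in which a letter 0 precedes each block (\<open>flat\<close> below).
  In an occurrence of 31-2 or 2-13 the separators can only play the role of 1, which stands for a
  letter that is still to be inserted. They do not count as descent bottoms, because the descent
  is accounted for when a letter is inserted at the end of the block.\<close>

fun descents :: "nat list \<Rightarrow> nat" where
  "descents (x # y # w) = of_bool (y \<noteq> 0 \<and> y < x) + descents (y # w)"
| "descents _ = 0"

fun occ_31_2 :: "nat list \<Rightarrow> nat" where
  "occ_31_2 (x # y # w) = length (filter (\<lambda>b. y < b \<and> b < x) w) + occ_31_2 (y # w)"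
| "occ_31_2 _ = 0"

fun ascents_across :: "nat \<Rightarrow> nat list \<Rightarrow> nat" where
  "ascents_across b (x # y # w) = of_bool (x < b \<and> b < y) + ascents_across b (y # w)"
| "ascents_across b _ = 0"

fun occ_2_13 :: "nat list \<Rightarrow> nat" where
  "occ_2_13 (x # w) = ascents_across x w + occ_2_13 w"
| "occ_2_13 [] = 0"

text \<open>The set \<open>A\<close> holds the letters to the left of the word. The four patterns say that the
  1 of a classical 312 pattern \<open>a c b\<close> is followed by a second letter \<open>d > c\<close>.\<close>

fun avoiding :: "nat set \<Rightarrow> nat list \<Rightarrow> bool" where
  "avoiding A (c # w) \<longleftrightarrow>
     (\<forall>a\<in>A. \<forall>b\<in>set w. \<forall>d\<in>set w. c < b \<and> b < a \<and> c < d \<longrightarrow> b = d) \<and> avoiding (insert c A) w"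
| "avoiding A [] \<longleftrightarrow> True"

definition flat :: "nat list list \<Rightarrow> nat list" where
  "flat bs = concat (map (Cons 0) bs)"

lemma flat_simps [simp]: "flat [] = []" "flat (b # bs) = 0 # b @ flat bs"
  by (simp_all add: flat_def)

lemma set_flat: "set (flat bs) \<subseteq> insert 0 (set (concat bs))"
  by (induction bs) auto

lemma flat_cases: "flat bs = [] \<or> (\<exists>w. flat bs = 0 # w)"
  by (cases bs) auto

abbreviation above :: "nat \<Rightarrow> nat list \<Rightarrow> bool" where
  "above v w \<equiv> \<forall>x\<in>set w. x = 0 \<or> v < x"

section \<open>Pattern avoidance under insertion of a small letter\<close>

text \<open>A member of \<open>A\<close> matters only if it exceeds some \<open>b\<close> with
  \<open>c < b\<close>; such a \<open>b\<close> is non-zero, hence at least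
  \<open>v\<close>.\<close>

lemma avoiding_insert_small:
  assumes "\<And>x. x \<in> set w \<Longrightarrow> x = 0 \<or> v \<le> x"
  shows "avoiding (insert v A) w = avoiding A w"
  using assms
proof (induction A w rule: avoiding.induct)
  case (1 A c w)
  have "b \<ge> v" if "b \<in> set w" "c < b" for b
    using 1(2)[of b] that by auto
  moreover have "avoiding (insert v (insert c A)) w = avoiding (insert c A) w"
    using 1 by auto
  ultimately show ?case by (fastforce simp: insert_commute)
qed simp

text \<open>Only one letter follows the new separator, so \<open>b\<close> and \<open>d\<close>
  would coincide there; 0 and \<open>v\<close> are too small to follow an earlier letter as
  \<open>b\<close> or \<open>d\<close>.\<close>

lemma avoiding_append_ascending_pair:
  assumes "\<forall>x\<in>set w. v < x"
  shows "avoiding A (w @ [0, v]) = avoiding A w"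
  using assms
  by (induction A w rule: avoiding.induct) auto

text \<open>As a 1, \<open>v\<close> imposes no more than the separator right behind it, since every
  later non-zero letter exceeds \<open>v\<close>; as a 3 it is too small.\<close>

lemma avoiding_insert_after:
  assumes "\<forall>x\<in>set w. v < x" "above v z" "z = [] \<or> (\<exists>y. z = 0 # y)" "0 < v"
  shows "avoiding A (w @ v # z) = avoiding A (w @ z)"
  using assms(1)
proof (induction w arbitrary: A)
  case Nil
  show ?case
  proof (cases z)
    case (Cons c y)
    with assms have z: "z = 0 # y" by auto
    have y: "x = 0 \<or> v < x" if "x \<in> set y" for x using assms z that by auto
    have "avoiding (insert v (insert 0 A)) y = avoiding (insert 0 A) y"
      using y by (intro avoiding_insert_small) force
    moreover have "v < b \<longleftrightarrow> 0 < b" "0 < b \<Longrightarrow> \<not> b < v" if "b \<in> set y" for b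
      using y[OF that] assms(4) by auto
    ultimately show ?thesis
      by (auto simp: z insert_commute)
  qed (simp)
next
  case (Cons c w)
  have "(\<forall>b\<in>set (w @ v # z). P b \<longrightarrow> c < b \<longrightarrow> Q b) \<longleftrightarrow>
    (\<forall>b\<in>set (w @ z). P b \<longrightarrow> c < b \<longrightarrow> Q b)" for P Q
    using Cons.prems by auto
  then show ?case using Cons by auto
qed

lemma avoiding_merge:
  assumes "\<forall>x\<in>set w. v < x" "above v z" "0 < v"
  shows "avoiding A (w @ v # z) = avoiding A (w @ 0 # z)"
  using assms(1)
proof (induction w arbitrary: A)
  case Nil
  have "avoiding (insert v A) z = avoiding (insert 0 A) z"
    using avoiding_insert_small[of z v A] avoiding_insert_small[of z 0 A] assms by force
  moreover have "v < b \<longleftrightarrow> 0 < b" if "b \<in> set z" for b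
    using assms that by auto
  ultimately show ?case by auto
next
  case (Cons c w)
  then show ?case by auto
qed

lemma avoiding_appendD:
  assumes "avoiding A (w @ c # z)" "a \<in> A \<union> set w" "b \<in> set z" "d \<in> set z"
    "c < b" "b < a" "c < d"
  shows "b = d"
  using assms by (induction w arbitrary: A) auto

lemma avoiding_0_Cons:
  "avoiding {} (0 # w) = avoiding {} w"
  using avoiding_insert_small[of w 0 "{}"] by simp

section \<open>Change of the three statistics under such an insertion\<close>

lemma descents_0_Cons [simp]: "descents (0 # w) = descents w"
  by (cases w) auto

lemma descents_append_0: "descents (w @ 0 # z) = descents w + descents z"
  by (induction w rule: descents.induct) auto

lemma descents_small_Cons: "above v z \<Longrightarrow> descents (v # z) = descents z"
  by (cases z) auto

text \<open>The last letter of \<open>w\<close> and \<open>v\<close> form the one new descent;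
  whatever follows \<open>v\<close> is a separator or larger.\<close>

lemma descents_insert:
  assumes "\<forall>x\<in>set w. v < x" "above v z" "0 < v" "w \<noteq> []"
  shows "descents (w @ v # z) = Suc (descents w + descents z)"
  using assms by (induction w rule: descents.induct) (auto simp: descents_small_Cons)

lemma occ_31_2_small_Cons: "above v z \<Longrightarrow> occ_31_2 (v # z) = occ_31_2 z"
  by (cases z) (auto simp: filter_empty_conv)

lemma occ_31_2_0_Cons [simp]: "occ_31_2 (0 # w) = occ_31_2 w"
  by (cases w) auto

lemma occ_31_2_append_0: "occ_31_2 (w @ [0]) = occ_31_2 w"
  by (induction w rule: occ_31_2.induct) auto

lemma occ_31_2_append_0_0: "occ_31_2 (w @ 0 # 0 # z) = occ_31_2 (w @ 0 # z)"
  by (induction w rule: occ_31_2.induct) auto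

text \<open>The source of \<open>q\<close>: the last letter of \<open>w\<close>, the separator and
  \<open>v\<close> form the only new occurrence, as every pair inside \<open>w\<close> has its lower
  letter above \<open>v\<close>.\<close>

lemma occ_31_2_append_ascending_pair:
  assumes "\<forall>x\<in>set w. v < x" "0 < v" "w \<noteq> []"
  shows "occ_31_2 (w @ [0, v]) = Suc (occ_31_2 w)"
  using assms by (induction w rule: occ_31_2.induct) auto

text \<open>No letter of \<open>w\<close> is below \<open>v\<close>, so \<open>v\<close> is never
  the 2. As the 1 it acts like the separator, because the letters of \<open>z\<close> above
  \<open>v\<close> are just the non-zero ones.\<close>

lemma occ_31_2_merge:
  assumes "\<forall>x\<in>set w. v < x" "above v z" "0 < v"
  shows "occ_31_2 (w @ v # z) = occ_31_2 (w @ 0 # z)"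
  using assms(1)
proof (induction w rule: occ_31_2.induct)
  case ("2_2" x)
  have "filter (\<lambda>b. v < b \<and> b < x) z = filter (\<lambda>b. 0 < b \<and> b < x) z"
    using assms by (intro filter_cong) auto
  then show ?case using assms by (simp add: occ_31_2_small_Cons)
next
  case (1 x y w)
  have "filter (\<lambda>b. y < b \<and> b < x) (w @ v # z) = filter (\<lambda>b. y < b \<and> b < x) (w @ 0 # z)"
    using 1(2) by simp
  moreover have "occ_31_2 ((y # w) @ v # z) = occ_31_2 ((y # w) @ 0 # z)"
    using 1 by simp
  ultimately show ?case
    unfolding append_Cons occ_31_2.simps by simp
next
  case "2_1"
  show ?case by (simp add: occ_31_2_small_Cons assms(2))
qed

lemma ascents_across_merge:
  assumes "v < b"
  shows "ascents_across b (w @ v # z) = ascents_across b (w @ 0 # z)"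
  using assms by (induction b w rule: ascents_across.induct; cases z) auto

lemma ascents_across_append_0: "ascents_across b (w @ [0]) = ascents_across b w"
  by (induction b w rule: ascents_across.induct) auto

lemma ascents_across_append_0_0: "ascents_across b (w @ 0 # 0 # z) = ascents_across b (w @ 0 # z)"
  by (induction b w rule: ascents_across.induct) auto

lemma ascents_across_append_pair:
  assumes "v < b"
  shows "ascents_across b (w @ [0, v]) = ascents_across b w"
  using assms by (induction b w rule: ascents_across.induct) auto

lemma ascents_across_above:
  assumes "\<forall>x\<in>set w. b \<le> x"
  shows "ascents_across b (w @ z) = ascents_across b z"
  using assms
proof (induction w)
  case (Cons x w)
  then show ?case by (cases w; cases z) auto
qed simp

text \<open>Inside a block all letters exceed \<open>v\<close>, so the ascents across
  \<open>v\<close> are those from a separator into its non-empty block. This produces the powers of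
  \<open>p\<close>.\<close>

lemma ascents_across_flat:
  assumes "\<forall>b\<in>set bs. b \<noteq> [] \<and> (\<forall>x\<in>set b. v < x)" "0 < v"
  shows "ascents_across v (flat bs) = length bs"
  using assms(1)
proof (induction bs)
  case (Cons b bs)
  then obtain x y where b: "b = x # y" by (cases b) auto
  have "ascents_across v (b @ flat bs) = ascents_across v (flat bs)"
    using Cons.prems ascents_across_above[of b v "flat bs"] by (simp add: less_imp_le)
  then show ?case using Cons b assms by auto
qed simp

lemma ascents_across_0 [simp]: "ascents_across 0 w = 0"
  by (induction "0::nat" w rule: ascents_across.induct) auto

text \<open>For the larger letters of \<open>w\<close>, \<open>v\<close> is as low as the separator.
  The extra term has \<open>v\<close> in the role of 2, in which a separator counts nothing.\<close>

lemma occ_2_13_merge: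
  assumes "\<forall>x\<in>set w. v < x"
  shows "occ_2_13 (w @ v # z) = occ_2_13 (w @ 0 # z) + ascents_across v z"
  using assms by (induction w) (auto simp: ascents_across_merge[of v])

lemma occ_2_13_append_0: "occ_2_13 (w @ [0]) = occ_2_13 w"
  by (induction w) (auto simp: ascents_across_append_0)

lemma occ_2_13_append_0_0: "occ_2_13 (w @ 0 # 0 # z) = occ_2_13 (w @ 0 # z)"
  by (induction w) (auto simp: ascents_across_append_0_0)

lemma occ_2_13_append_ascending_pair:
  assumes "\<forall>x\<in>set w. v < x"
  shows "occ_2_13 (w @ [0, v]) = occ_2_13 w"
  using assms by (induction w) (auto simp: ascents_across_append_pair)

section \<open>Insertion of the smallest letter\<close>

definition blocks :: "nat set \<Rightarrow> nat list list \<Rightarrow> bool" where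
  "blocks S bs \<longleftrightarrow> bs \<noteq> [] \<and> [] \<notin> set bs \<and> distinct (concat bs) \<and> set (concat bs) = S"

fun children :: "nat \<Rightarrow> nat list list \<Rightarrow> nat list list set" where
  "children v [] = {}"
| "children v [b] = {[[v], b], [v # b], [b @ [v]], [b, [v]]}"
| "children v (b # c # bs) =
     {[v] # b # c # bs, (v # b) # c # bs, (b @ [v]) # c # bs, (b @ v # c) # bs}"

text \<open>A left inverse of insertion, used to keep the sets of children disjoint. Cutting at
  \<open>v\<close> and dropping empty halves undoes all cases but \<open>[b, [v]]\<close>, the one
  child with \<open>v\<close> outside the first block.\<close>

fun parent :: "nat \<Rightarrow> nat list list \<Rightarrow> nat list list" where
  "parent v [] = []"
| "parent v (b # bs) =
     (if v \<in> set b
      then filter (\<lambda>c. c \<noteq> []) [takeWhile (\<lambda>x. x \<noteq> v) b, tl (dropWhile (\<lambda>x. x \<noteq> v) b)] @ bs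
      else [b])"

lemma parent_Cons_split:
  assumes "v \<notin> set l"
  shows "parent v ((l @ v # r) # bs) = filter (\<lambda>c. c \<noteq> []) [l, r] @ bs"
proof -
  have "takeWhile (\<lambda>x. x \<noteq> v) (l @ v # r) = l" "dropWhile (\<lambda>x. x \<noteq> v) (l @ v # r) = v # r"
    using assms by (induction l) auto
  thus ?thesis by simp
qed

lemma parent_children:
  assumes "blocks S bs" "v \<notin> S" "bs' \<in> children v bs"
  shows "parent v bs' = bs"
  using assms
proof (induction v bs rule: children.induct)
  case (2 v b)
  then show ?case
    using parent_Cons_split[of v "[]" "[]" "[b]"] parent_Cons_split[of v "[]" b "[]"]
      parent_Cons_split[of v b "[]" "[]"]
    by (auto simp: blocks_def)
next
  case (3 v b c bs)
  then show ?case
    using parent_Cons_split[of v "[]" "[]" "b # c # bs"] parent_Cons_split[of v "[]" b "c # bs"]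
      parent_Cons_split[of v b "[]" "c # bs"] parent_Cons_split[of v b c bs]
    by (auto simp: blocks_def)
qed simp

lemma blocks_children:
  assumes "blocks S bs" "v \<notin> S" "bs' \<in> children v bs"
  shows "blocks (insert v S) bs'"
  using assms by (induction v bs rule: children.induct) (auto simp: blocks_def)

lemma sum_children:
  assumes "blocks S bs" "v \<notin> S"
  shows "sum f (children v bs) =
    (case bs of [b] \<Rightarrow> f [[v], b] + f [v # b] + f [b @ [v]] + f [b, [v]]
     | b # c # cs \<Rightarrow> f ([v] # bs) + f ((v # b) # c # cs) + f ((b @ [v]) # c # cs) + f ((b @ v # c) # cs))"
  using assms
proof (induction v bs rule: children.induct)
  case (2 v b)
  then show ?case by (cases b) (auto simp: blocks_def add_ac)
next
  case (3 v b c bs)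
  \<comment> \<open>Merging loses a block, so the result differs from both extensions of
    \<open>b\<close>.\<close>
  moreover have "(b @ v # c) # bs \<noteq> X # c # bs" for X
    by (auto dest: arg_cong[of _ _ length])
  ultimately show ?case by (cases b) (auto simp: blocks_def add_ac)
qed (simp add: blocks_def)

text \<open>At the front no letter precedes \<open>v\<close>; behind the first block or between two
  blocks \<open>v\<close> acts like the adjacent or replaced separator. The equality serves both
  insertion and removal of \<open>v\<close>.\<close>

lemma avoiding_children:
  assumes bs: "blocks S bs" and S: "\<forall>x\<in>S. v < x" and "0 < v" "bs' \<in> children v bs"
  shows "avoiding {} (flat bs') = avoiding {} (flat bs)"
proof -
  have abv: "above v (flat cs)" if "set cs \<subseteq> set bs" for cs
    using set_flat[of cs] bs S that by (fastforce simp: blocks_def)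
  have b0: "avoiding {} (0 # v # w) = avoiding {} (0 # w)" if "above v w" for w
  proof -
    have "avoiding {v} w = avoiding {} w"
      by (rule avoiding_insert_small) (use that in force)
    thus ?thesis unfolding avoiding_0_Cons by simp
  qed
  obtain b cs where bs_eq: "bs = b # cs"
    using bs by (cases bs) (auto simp: blocks_def)
  have b: "\<forall>x\<in>set b. v < x"
    using bs S by (auto simp: blocks_def bs_eq)
  have A: "avoiding {} (0 # v # b @ flat cs) = avoiding {} (0 # b @ flat cs)"
    using abv[of cs] b by (intro b0) (auto simp: bs_eq)
  have U: "avoiding {} (0 # v # 0 # b @ flat cs) = avoiding {} (0 # b @ flat cs)"
    using abv[of bs] b0[of "flat bs"] unfolding bs_eq by (simp add: avoiding_0_Cons del: avoiding.simps)
  have D: "avoiding {} (0 # b @ v # flat cs) = avoiding {} (0 # b @ flat cs)"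
    unfolding avoiding_0_Cons using abv[of cs] flat_cases[of cs] b \<open>0 < v\<close>
    by (intro avoiding_insert_after) (auto simp: bs_eq)
  show ?thesis
  proof (cases cs)
    case Nil
    have R: "avoiding {} (0 # b @ [0, v]) = avoiding {} (0 # b)"
      unfolding avoiding_0_Cons using b by (intro avoiding_append_ascending_pair) auto
    show ?thesis
      using assms(4) A U D R by (auto simp: bs_eq Nil simp del: avoiding.simps)
  next
    case (Cons c ds)
    have V: "avoiding {} (0 # b @ v # c @ flat ds) = avoiding {} (0 # b @ 0 # c @ flat ds)"
      unfolding avoiding_0_Cons using abv[of cs] b \<open>0 < v\<close>
      by (intro avoiding_merge) (auto simp: bs_eq Cons)
    show ?thesis
      using assms(4) A U D V by (auto simp: bs_eq Cons simp del: avoiding.simps)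
  qed
qed

text \<open>The states once \<open>m, ..., v\<close> are inserted, described by avoidance instead of
  by their insertion history.\<close>

definition configs :: "nat \<Rightarrow> nat \<Rightarrow> nat list list set" where
  "configs v m = {bs. blocks {v..m} bs \<and> avoiding {} (flat bs)}"

text \<open>Otherwise a letter of the first block, the separator after it, \<open>v\<close> and any other later letter
  would form a forbidden pattern.\<close>

lemma smallest_letter_position:
  assumes bs: "blocks {v..m} (b # bs)" and "avoiding {} (flat (b # bs))" "0 < v" "v \<le> m"
    "v \<notin> set b"
  shows "bs = [[v]]"
proof -
  obtain a where a: "a \<in> set b"
    using bs by (cases b) (auto simp: blocks_def)
  have "a \<in> {v..m}"
    using bs a by (auto simp: blocks_def)
  hence av: "v < a"
    using a assms(5) by (cases "a = v") auto
  have "v \<in> set (concat (b # bs))"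
    using bs assms by (simp add: blocks_def)
  hence v: "v \<in> set (concat bs)"
    using assms(5) by simp
  obtain c cs where bs_eq: "bs = c # cs"
    using v by (cases bs) auto
  have "v = d" if d: "d \<in> set (concat bs)" for d
  proof (rule avoiding_appendD)
    show "avoiding {} ((0 # b) @ 0 # (c @ flat cs))"
      using assms(2) by (simp add: bs_eq)
    have "set (concat xs) \<subseteq> set (flat xs)" for xs
      by (induction xs) auto
    thus "v \<in> set (c @ flat cs)" "d \<in> set (c @ flat cs)"
      using v d by (auto simp: bs_eq)
    have "d \<in> {v..m}" using bs d by (auto simp: blocks_def)
    thus "0 < d" using \<open>0 < v\<close> by auto
  qed (use a av \<open>0 < v\<close> in auto)
  hence "set (concat bs) \<subseteq> {v}" "distinct (concat bs)" "[] \<notin> set bs"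
    using bs by (auto simp: blocks_def)
  moreover have "concat bs = [v]" if "set (concat bs) \<subseteq> {v}" "distinct (concat bs)"
    using that v by (cases "concat bs"; cases "tl (concat bs)") auto
  ultimately show ?thesis
    by (auto simp: bs_eq append_eq_Cons_conv) (metis concat_eq_Nil_conv list.set_intros(1) list.exhaust)
qed

text \<open>Removing \<open>v\<close> undoes an insertion: either \<open>v\<close> lies in the first
  block, which is cut there, or it is the only letter behind that block.\<close>

lemma configs_parent:
  assumes "bs \<in> configs v m" "0 < v" "v < m"
  shows "\<exists>bs'\<in>configs (Suc v) m. bs \<in> children v bs'"
proof -
  have bs: "blocks {v..m} bs" and av: "avoiding {} (flat bs)"
    using assms(1) by (auto simp: configs_def)
  obtain b cs where bs_eq: "bs = b # cs"
    using bs by (cases bs) (auto simp: blocks_def)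
  have "\<exists>bs'. blocks ({v..m} - {v}) bs' \<and> bs \<in> children v bs'"
  proof (cases "v \<in> set b")
    case False
    hence "cs = [[v]]"
      using smallest_letter_position bs av assms unfolding bs_eq by fastforce
    hence "blocks ({v..m} - {v}) [b] \<and> bs \<in> children v [b]"
      using bs False by (auto simp: blocks_def bs_eq)
    thus ?thesis ..
  next
    case True
    then obtain l r where b: "b = l @ v # r"
      by (meson split_list)
    define bs' where "bs' = filter (\<lambda>c. c \<noteq> []) [l, r] @ cs"
    have "concat bs' = l @ r @ concat cs"
      by (auto simp: bs'_def)
    hence S: "set (concat bs') = {v..m} - {v}" "distinct (concat bs')"
      using bs by (auto simp: blocks_def bs_eq b)
    \<comment> \<open>By \<open>v < m\<close> a letter remains after the removal, so the smaller
      list has a block.\<close>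
    moreover have "m \<in> {v..m} - {v}" using assms by simp
    ultimately have "bs' \<noteq> []" by auto
    with S have "blocks ({v..m} - {v}) bs'"
      using bs by (auto simp: blocks_def bs'_def bs_eq)
    moreover have "bs \<in> children v bs'"
      using \<open>bs' \<noteq> []\<close> by (cases cs; cases "tl cs") (auto simp: bs'_def bs_eq b)
    ultimately show ?thesis by blast
  qed
  moreover have "{v..m} - {v} = {Suc v..m}" by auto
  ultimately obtain bs' where bs': "blocks {Suc v..m} bs'" "bs \<in> children v bs'" by auto
  moreover have "avoiding {} (flat bs')"
    using avoiding_children[OF bs'(1) _ \<open>0 < v\<close> bs'(2)] av by auto
  ultimately show ?thesis by (auto simp: configs_def)
qed

lemma configs_step:
  assumes "0 < v" "v < m"
  shows "configs v m = (\<Union>bs\<in>configs (Suc v) m. children v bs)"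
proof (intro equalityI subsetI)
  fix bs assume "bs \<in> (\<Union>bs\<in>configs (Suc v) m. children v bs)"
  then obtain bs' where bs': "blocks {Suc v..m} bs'" "avoiding {} (flat bs')" "bs \<in> children v bs'"
    by (auto simp: configs_def)
  moreover have "insert v {Suc v..m} = {v..m}" using assms by auto
  ultimately show "bs \<in> configs v m"
    using blocks_children[OF bs'(1) _ bs'(3)] avoiding_children[OF bs'(1) _ \<open>0 < v\<close> bs'(3)]
    by (auto simp: configs_def)
qed (use configs_parent assms in blast)

lemma configs_last: "0 < m \<Longrightarrow> configs m m = {[[m]]}"
proof -
  have "bs = [[m]]" if "blocks {m} bs" for bs
  proof -
    have "concat bs = [m]"
      using that by (cases "concat bs"; cases "tl (concat bs)") (auto simp: blocks_def)
    thus ?thesis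
      using that by (cases bs; cases "tl bs") (auto simp: blocks_def append_eq_Cons_conv)
  qed
  thus ?thesis by (auto simp: configs_def blocks_def)
qed

lemma finite_children: "finite (children v bs)"
  by (induction v bs rule: children.induct) auto

lemma finite_configs:
  assumes "0 < v" "v \<le> m"
  shows "finite (configs v m)"
  using assms(2,1) by (induction rule: inc_induct) (auto simp: configs_step configs_last finite_children)

lemma sum_configs_step:
  assumes "0 < v" "v < m"
  shows "sum f (configs v m) = (\<Sum>bs\<in>configs (Suc v) m. sum f (children v bs))"
  unfolding configs_step[OF assms]
proof (rule sum.UNION_disjoint)
  \<comment> \<open>A list is recovered from each of its children, so different lists share
    none.\<close>
  have "parent v bs' = bs" if "bs \<in> configs (Suc v) m" "bs' \<in> children v bs" for bs bs'
    using that parent_children[of "{Suc v..m}" bs v bs'] by (simp add: configs_def)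
  thus "\<forall>bs\<in>configs (Suc v) m. \<forall>bs'\<in>configs (Suc v) m.
    bs \<noteq> bs' \<longrightarrow> children v bs \<inter> children v bs' = {}"
    by blast
qed (use assms in \<open>auto simp: finite_configs finite_children\<close>)

section \<open>Monomial weights of the insertions\<close>

lemma occ_31_2_children:
  assumes b: "\<forall>x\<in>set b. v < x" "b \<noteq> []" and "above v z" "0 < v"
  shows "occ_31_2 (v # b @ z) = occ_31_2 (b @ z)"
    and "occ_31_2 (v # 0 # b @ z) = occ_31_2 (b @ z)"
    and "z = [] \<or> (\<exists>y. z = 0 # y) \<Longrightarrow> occ_31_2 (b @ v # z) = occ_31_2 (b @ z)"
    and "occ_31_2 (b @ v # z) = occ_31_2 (b @ 0 # z)"
proof -
  have ab: "above v (b @ z)" "above v (0 # b @ z)"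
    using assms by auto
  show "occ_31_2 (v # b @ z) = occ_31_2 (b @ z)" "occ_31_2 (v # 0 # b @ z) = occ_31_2 (b @ z)"
    using occ_31_2_small_Cons[OF ab(1)] occ_31_2_small_Cons[OF ab(2)] by simp_all
  show "occ_31_2 (b @ v # z) = occ_31_2 (b @ z)" if "z = [] \<or> (\<exists>y. z = 0 # y)"
    using that assms by (auto simp: occ_31_2_merge[of b v] occ_31_2_append_0 occ_31_2_append_0_0)
  show "occ_31_2 (b @ v # z) = occ_31_2 (b @ 0 # z)"
    using assms by (intro occ_31_2_merge) auto
qed

lemma occ_2_13_insert_after:
  assumes "\<forall>x\<in>set b. v < x" "z = [] \<or> (\<exists>y. z = 0 # y)"
  shows "occ_2_13 (b @ v # z) = occ_2_13 (b @ z) + ascents_across v z"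
  using assms by (auto simp: occ_2_13_merge occ_2_13_append_0 occ_2_13_append_0_0)

context
  fixes p q t :: "'a::comm_ring_1"
begin

definition weight :: "nat list \<Rightarrow> 'a" where
  "weight w = p ^ occ_2_13 w * q ^ occ_31_2 w * t ^ descents w"

text \<open>\<open>p\<close> counts the blocks to the right of \<open>v\<close> that do not touch
  it, \<open>t\<close> records a letter directly in front of \<open>v\<close> in its block, and
  \<open>q\<close> arises when the first block stays to the left of \<open>v\<close>,
  untouched.\<close>

lemma weight_children:
  assumes bs: "blocks S (b # cs)" and S: "\<forall>x\<in>S. v < x" and v: "0 < v"
  shows "weight (flat ([v] # b # cs)) = p ^ Suc (length cs) * weight (flat (b # cs))"
    and "weight (flat ((v # b) # cs)) = p ^ length cs * weight (flat (b # cs))"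
    and "weight (flat ((b @ [v]) # cs)) = t * p ^ length cs * weight (flat (b # cs))"
    and "cs = [] \<Longrightarrow> weight (flat [b, [v]]) = q * weight (flat (b # cs))"
    and "cs = c # ds \<Longrightarrow> weight (flat ((b @ v # c) # ds)) = t * p ^ length ds * weight (flat (b # cs))"
proof -
  have b: "\<forall>x\<in>set b. v < x" "b \<noteq> []" and b': "\<forall>x\<in>set b. v \<le> x"
    using bs S by (auto simp: blocks_def order.strict_iff_order)
  have asc: "ascents_across v (flat ds) = length ds" if "set ds \<subseteq> set (b # cs)" for ds
    using that bs S v by (intro ascents_across_flat) (fastforce simp: blocks_def)+
  have abv: "above v (flat ds)" if "set ds \<subseteq> set (b # cs)" for ds
    using set_flat[of ds] bs S that by (fastforce simp: blocks_def)
  note cs = asc[OF set_subset_Cons] abv[OF set_subset_Cons] flat_cases[of cs]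
  have ab: "above v (b @ flat cs)"
    using b cs by auto
  have asc_b: "ascents_across v (0 # b @ flat cs) = Suc (length cs)"
    using asc[of "b # cs"] by simp
  have asc_b': "ascents_across v (b @ flat cs) = length cs"
    using cs ascents_across_above[OF b', of "flat cs"] by simp
  have "descents (b @ flat cs) = descents b + descents (flat cs)"
    using cs(3) descents_append_0[of b] by auto
  note des = this
  show "weight (flat ([v] # b # cs)) = p ^ Suc (length cs) * weight (flat (b # cs))"
    using occ_31_2_children[OF b cs(2) v] descents_small_Cons[of "0 # b @ flat cs" v] ab asc_b
    by (simp add: weight_def power_add algebra_simps)
  show "weight (flat ((v # b) # cs)) = p ^ length cs * weight (flat (b # cs))"
    using occ_31_2_children[OF b cs(2) v] descents_small_Cons[of "b @ flat cs" v] ab asc_b'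
    by (simp add: weight_def power_add algebra_simps)
  show "weight (flat ((b @ [v]) # cs)) = t * p ^ length cs * weight (flat (b # cs))"
    using occ_31_2_children[OF b cs(2) v] occ_2_13_insert_after[OF b(1) cs(3)]
      descents_insert[OF b(1) cs(2) v b(2)] des cs
    by (simp add: weight_def power_add algebra_simps)
  show "weight (flat [b, [v]]) = q * weight (flat (b # cs))" if "cs = []"
    using occ_31_2_append_ascending_pair[OF b(1) v b(2)] occ_2_13_append_ascending_pair[OF b(1)]
      descents_append_0[of b "[v]"] that
    by (simp add: weight_def power_add algebra_simps)
  show "weight (flat ((b @ v # c) # ds)) = t * p ^ length ds * weight (flat (b # cs))" if "cs = c # ds"
  proof -
    have c: "\<forall>x\<in>set c. v \<le> x"
      using bs S that by (auto simp: blocks_def order.strict_iff_order)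
    have z: "above v (c @ flat ds)"
      using abv[of cs] that by auto
    have "ascents_across v (c @ flat ds) = length ds"
      using asc[of ds] that ascents_across_above[OF c, of "flat ds"] by (simp add: subset_insertI2)
    thus ?thesis
      using occ_31_2_children(4)[OF b z v] occ_2_13_merge[OF b(1), of "c @ flat ds"]
        descents_insert[OF b(1) z v b(2)] des that
      by (simp add: weight_def power_add algebra_simps)
  qed
qed

text \<open>With \<open>h + 1\<close> blocks, a new front block has all of them on its right; at
  height 0 a block behind contributes \<open>q\<close>. A merge leaves \<open>h - 1\<close> blocks
  to the right, hence the exponent in \<open>down_weight\<close>.\<close>

definition up_weight :: "nat \<Rightarrow> 'a" where "up_weight h = (if h = 0 then p + q else p ^ Suc h)"
definition level_weight :: "nat \<Rightarrow> 'a" where "level_weight h = p ^ h * (1 + t)"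
definition down_weight :: "nat \<Rightarrow> 'a" where "down_weight h = p ^ (h - 1) * t"

text \<open>The children realise one step of the \<open>motzkin\<close> recurrence: an up step, two
  level steps with factors 1 and \<open>t\<close>, and a down step, which at height 0 is replaced by
  a second up step.\<close>

lemma sum_weight_children:
  assumes bs: "blocks S bs" and S: "\<forall>x\<in>S. v < x" and v: "0 < v"
  shows "(\<Sum>bs'\<in>children v bs. weight (flat bs') * motzkin up_weight level_weight down_weight n (length bs' - 1))
    = weight (flat bs) * motzkin up_weight level_weight down_weight (Suc n) (length bs - 1)"
proof -
  obtain b cs where bs_eq: "bs = b # cs"
    using bs by (cases bs) (auto simp: blocks_def)
  have "v \<notin> S" using S by auto
  note sum = sum_children[OF bs this]
  note wt = weight_children[OF bs[unfolded bs_eq] S v]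
  show ?thesis
  proof (cases cs)
    case Nil
    show ?thesis
      unfolding sum using wt(1-4)
      by (simp add: bs_eq Nil up_weight_def level_weight_def down_weight_def algebra_simps del: flat_simps)
  next
    case (Cons c ds)
    show ?thesis
      unfolding sum using wt(1-3) wt(5)[OF Cons]
      by (simp add: bs_eq Cons up_weight_def level_weight_def down_weight_def algebra_simps del: flat_simps)
  qed
qed

text \<open>An invariant of the insertion: the \<open>v - 1\<close> missing letters are the
  remaining steps, and each list is weighted by the paths that complete it. At \<open>v = m\<close>
  only \<open>[[m]]\<close>, of weight 1, is left.\<close>

lemma sum_weight_configs:
  assumes "1 \<le> v" "v \<le> m"
  shows "(\<Sum>bs\<in>configs v m. weight (flat bs) * motzkin up_weight level_weight down_weight (v - 1) (length bs - 1))
    = motzkin up_weight level_weight down_weight (m - 1) 0"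
  using assms(2,1)
proof (induction rule: inc_induct)
  case base
  then show ?case by (simp add: configs_last weight_def)
next
  case (step v)
  let ?M = "motzkin up_weight level_weight down_weight"
  have "(\<Sum>bs\<in>configs v m. weight (flat bs) * ?M (v - 1) (length bs - 1)) =
    (\<Sum>bs\<in>configs (Suc v) m. \<Sum>bs'\<in>children v bs. weight (flat bs') * ?M (v - 1) (length bs' - 1))"
    using step by (intro sum_configs_step) auto
  also have "\<dots> = (\<Sum>bs\<in>configs (Suc v) m. weight (flat bs) * ?M (Suc (v - 1)) (length bs - 1))"
    using step by (intro sum.cong refl sum_weight_children[of "{Suc v..m}"]) (auto simp: configs_def)
  finally show ?case using step by simp
qed

section \<open>Words as lists with a single block\<close>

definition avoiding_words :: "nat \<Rightarrow> nat list set" where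
  "avoiding_words m = {w. distinct w \<and> set w = {1..m} \<and> avoiding {} w}"

lemma sum_weight_avoiding_words:
  assumes "0 < m"
  shows "(\<Sum>w\<in>avoiding_words m. weight w) = motzkin up_weight level_weight down_weight (m - 1) 0"
proof -
  have "(\<Sum>w\<in>avoiding_words m. weight w) =
    (\<Sum>bs\<in>(\<lambda>w. [w]) ` avoiding_words m. weight (flat bs) * motzkin up_weight level_weight down_weight 0 (length bs - 1))"
    by (subst sum.reindex) (auto simp: inj_on_def weight_def)
  also have "\<dots> = (\<Sum>bs\<in>configs 1 m. weight (flat bs) * motzkin up_weight level_weight down_weight 0 (length bs - 1))"
  proof (rule sum.mono_neutral_left)
    show "(\<lambda>w. [w]) ` avoiding_words m \<subseteq> configs 1 m"
      using assms avoiding_0_Cons by (auto simp: avoiding_words_def configs_def blocks_def simp del: avoiding.simps)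
    \<comment> \<open>With no steps left, \<open>motzkin\<close> vanishes off height 0, which
      discards the lists with several blocks.\<close>
    show "\<forall>bs\<in>configs 1 m - (\<lambda>w. [w]) ` avoiding_words m.
      weight (flat bs) * motzkin up_weight level_weight down_weight 0 (length bs - 1) = 0"
    proof
      fix bs assume bs: "bs \<in> configs 1 m - (\<lambda>w. [w]) ` avoiding_words m"
      have "length bs \<noteq> 1"
        using bs avoiding_0_Cons
        by (auto simp: avoiding_words_def configs_def blocks_def length_Suc_conv simp del: avoiding.simps)
      moreover have "bs \<noteq> []" using bs by (auto simp: configs_def blocks_def)
      ultimately have "length bs - 1 \<noteq> 0"
        by (cases bs) auto
      thus "weight (flat bs) * motzkin up_weight level_weight down_weight 0 (length bs - 1) = 0" by simp
    qed
  qed (use assms finite_configs in auto)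
  finally show ?thesis
    using sum_weight_configs[of 1 m] assms by simp
qed

text \<open>\<open>up_weight h * down_weight (Suc h)\<close> is (p + q) t for \<open>h = 0\<close>
  and p^(2h+1) t otherwise, the partial numerator of index \<open>h + 1\<close>.\<close>

lemma B_poly_eq_motzkin: "B_poly n p q t = motzkin up_weight level_weight down_weight n 0"
  unfolding B_poly_def
  apply (subst jfrac_nth_eq_motzkin[where u = up_weight and d = down_weight])
  subgoal for h by (cases h) (simp_all add: up_weight_def down_weight_def power_add mult_2 mult_2_right algebra_simps)
  by (simp add: level_weight_def[abs_def])

end

section \<open>Permutations as words\<close>

lemma card_shift_Suc: "card {j. 0 < j \<and> P j} = card {j. P (Suc j)}"
proof -
  have "{j. 0 < j \<and> P j} = Suc ` {j. P (Suc j)}"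
  proof (rule set_eqI)
    fix j show "j \<in> {j. 0 < j \<and> P j} \<longleftrightarrow> j \<in> Suc ` {j. P (Suc j)}"
      by (cases j) auto
  qed
  thus ?thesis by (simp add: card_image)
qed

text \<open>Peels off the first adjacent pair, in step with the recursive equations of the word
  statistics.\<close>

lemma card_adjacent_Cons:
  "card {i. Suc i < length (x # y # w) \<and> P i} =
     of_bool (P 0) + card {i. Suc i < length (y # w) \<and> P (Suc i)}"
proof -
  let ?S = "{i. Suc i < length (y # w) \<and> P (Suc i)}"
  have "{i. Suc i < length (x # y # w) \<and> P i} = {i. i = 0 \<and> P 0} \<union> Suc ` ?S" (is "?T = ?U")
  proof (rule set_eqI)
    fix i show "i \<in> ?T \<longleftrightarrow> i \<in> ?U"
      by (cases i) auto
  qed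
  moreover have "finite ?S"
    by (rule finite_subset[of _ "{..length w}"]) auto
  moreover have "{i. i = 0 \<and> P 0} = (if P 0 then {0} else {})"
    by auto
  ultimately have "card ?T = card (if P 0 then {0::nat} else {}) + card (Suc ` ?S)"
    by (simp add: card_Un_disjoint disjoint_iff)
  thus ?thesis by (simp add: card_image)
qed

section \<open>Recursive statistics as counts of positions\<close>

text \<open>Separators are excluded because \<open>descents\<close> skips descents into
  them.\<close>

lemma descents_eq_card:
  assumes "0 \<notin> set w"
  shows "descents w = card {i. Suc i < length w \<and> w ! Suc i < w ! i}"
  using assms
proof (induction w rule: descents.induct)
  case (1 x y w)
  then show ?case unfolding card_adjacent_Cons by simp
qed auto

lemma ascents_across_eq_card:
  "ascents_across b w = card {i. Suc i < length w \<and> w ! i < b \<and> b < w ! Suc i}"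
proof (induction b w rule: ascents_across.induct)
  case (1 b x y w)
  then show ?case unfolding card_adjacent_Cons by simp
qed auto

text \<open>\<open>occ_31_2\<close> groups occurrences by the pair 31, the statistic groups them by
  the 2. Peeling letters off the right end regroups them.\<close>

lemma occ_31_2_snoc:
  "occ_31_2 (w @ [b]) = occ_31_2 w + card {i. Suc i < length w \<and> w ! Suc i < b \<and> b < w ! i}"
proof (induction w rule: occ_31_2.induct)
  case (1 x y w)
  then show ?case unfolding card_adjacent_Cons by simp
qed auto

lemma occ_31_2_eq_sum:
  "occ_31_2 w = (\<Sum>i<length w. card {j. Suc j < i \<and> w ! Suc j < w ! i \<and> w ! i < w ! j})"
proof (induction w rule: rev_induct)
  case (snoc b w)
  have "(\<Sum>i<length w. card {j. Suc j < i \<and> (w @ [b]) ! Suc j < (w @ [b]) ! i \<and> (w @ [b]) ! i < (w @ [b]) ! j})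
    = occ_31_2 w"
    unfolding snoc
    by (intro sum.cong refl arg_cong[of _ _ card] Collect_cong) (auto simp: nth_append)
  moreover have "{j. Suc j < length w \<and> (w @ [b]) ! Suc j < b \<and> b < (w @ [b]) ! j}
    = {j. Suc j < length w \<and> w ! Suc j < b \<and> b < w ! j}"
    by (auto simp: nth_append)
  ultimately show ?case by (simp add: occ_31_2_snoc)
qed simp

lemma occ_2_13_eq_sum:
  "occ_2_13 w = (\<Sum>i<length w. card {j. i < j \<and> Suc j < length w \<and> w ! j < w ! i \<and> w ! i < w ! Suc j})"
proof (induction w)
  case (Cons x w)
  have "card {j. i < j \<and> Suc j < length (x # w) \<and> (x # w) ! j < a \<and> a < (x # w) ! Suc j} =
    card {j. i < Suc j \<and> Suc j < length w \<and> w ! j < a \<and> a < w ! Suc j}" for i a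
  proof -
    have "{j. i < j \<and> Suc j < length (x # w) \<and> (x # w) ! j < a \<and> a < (x # w) ! Suc j} =
      {j. 0 < j \<and> i < j \<and> Suc j < length (x # w) \<and> (x # w) ! j < a \<and> a < (x # w) ! Suc j}"
      by auto
    thus ?thesis by (simp only: card_shift_Suc length_Cons nth_Cons_Suc Suc_less_eq)
  qed
  thus ?case
    by (simp add: Cons.IH ascents_across_eq_card sum.lessThan_Suc_shift del: sum.lessThan_Suc)
qed simp

lemma avoiding_iff:
  "avoiding A w \<longleftrightarrow> (\<forall>j<length w. \<forall>a\<in>A \<union> set (take j w). \<forall>b\<in>set (drop (Suc j) w).
     \<forall>d\<in>set (drop (Suc j) w). w ! j < b \<and> b < a \<and> w ! j < d \<longrightarrow> b = d)"
proof (induction A w rule: avoiding.induct)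
  case (1 A c w)
  show ?case
    unfolding avoiding.simps 1 length_Cons All_less_Suc2 by simp
qed simp

definition word :: "nat \<Rightarrow> (nat \<Rightarrow> nat) \<Rightarrow> nat list" where
  "word m \<sigma> = map \<sigma> [1..<Suc m]"

lemma length_word [simp]: "length (word m \<sigma>) = m"
  by (simp add: word_def)

lemma nth_word [simp]: "i < m \<Longrightarrow> word m \<sigma> ! i = \<sigma> (Suc i)"
  by (simp add: word_def del: upt_Suc)

lemma set_word: "set (word m \<sigma>) = \<sigma> ` {1..m}"
  by (simp add: word_def atLeastLessThanSuc_atLeastAtMost del: upt_Suc)

lemma des_eq_descents:
  assumes "\<sigma> permutes {1..m}"
  shows "des m \<sigma> = descents (word m \<sigma>)"
proof -
  have "0 \<notin> set (word m \<sigma>)"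
    using permutes_image[OF assms] by (simp add: set_word)
  moreover have "des m \<sigma> = card {i. 0 < i \<and> i < m \<and> \<sigma> (i + 1) < \<sigma> i}"
    unfolding des_def by (simp only: One_nat_def Suc_le_eq)
  ultimately show ?thesis
    unfolding card_shift_Suc by (auto simp: descents_eq_card intro!: arg_cong[of _ _ card])
qed

lemma stat_2_13_eq: "stat_2_13 m \<sigma> = occ_2_13 (word m \<sigma>)"
proof -
  have "card {j. Suc i < j \<and> j < m \<and> \<sigma> j < \<sigma> (Suc i) \<and> \<sigma> (Suc i) < \<sigma> (j + 1)} =
    card {j. i < j \<and> Suc j < m \<and> word m \<sigma> ! j < word m \<sigma> ! i \<and> word m \<sigma> ! i < word m \<sigma> ! Suc j}"
    if "i < m" for i
  proof -
    have "card {j. Suc i < j \<and> j < m \<and> \<sigma> j < \<sigma> (Suc i) \<and> \<sigma> (Suc i) < \<sigma> (j + 1)} =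
      card {j. 0 < j \<and> Suc i < j \<and> j < m \<and> \<sigma> j < \<sigma> (Suc i) \<and> \<sigma> (Suc i) < \<sigma> (j + 1)}"
      by (intro arg_cong[of _ _ card] Collect_cong) auto
    also have "\<dots> = card {j. i < j \<and> Suc j < m \<and> word m \<sigma> ! j < word m \<sigma> ! i \<and> word m \<sigma> ! i < word m \<sigma> ! Suc j}"
      unfolding card_shift_Suc using that by (intro arg_cong[of _ _ card] Collect_cong) auto
    finally show ?thesis .
  qed
  thus ?thesis
    unfolding stat_2_13_def occ_2_13_eq_sum by (simp add: sum.atLeast1_atMost_eq)
qed

lemma stat_31_2_eq: "stat_31_2 m \<sigma> = occ_31_2 (word m \<sigma>)"
proof -
  have "card {j. 1 < j \<and> j < Suc i \<and> \<sigma> j < \<sigma> (Suc i) \<and> \<sigma> (Suc i) < \<sigma> (j - 1)} =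
    card {j. Suc j < i \<and> word m \<sigma> ! Suc j < word m \<sigma> ! i \<and> word m \<sigma> ! i < word m \<sigma> ! j}"
    if "i < m" for i
  proof -
    \<comment> \<open>Two shifts follow: one from positions to list indices, one because
      \<open>j\<close> marks the lower letter of the pair here but the upper one in the
      list.\<close>
    have "card {j. 1 < j \<and> j < Suc i \<and> \<sigma> j < \<sigma> (Suc i) \<and> \<sigma> (Suc i) < \<sigma> (j - 1)} =
      card {j. 0 < j \<and> 1 < j \<and> j < Suc i \<and> \<sigma> j < \<sigma> (Suc i) \<and> \<sigma> (Suc i) < \<sigma> (j - 1)}"
      by (intro arg_cong[of _ _ card] Collect_cong) auto
    also have "\<dots> = card {j. 0 < j \<and> j < i \<and> \<sigma> (Suc j) < \<sigma> (Suc i) \<and> \<sigma> (Suc i) < \<sigma> j}"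
      by (subst card_shift_Suc) (intro arg_cong[of _ _ card] Collect_cong, auto)
    also have "\<dots> = card {j. Suc j < i \<and> word m \<sigma> ! Suc j < word m \<sigma> ! i \<and> word m \<sigma> ! i < word m \<sigma> ! j}"
      unfolding card_shift_Suc using that by (intro arg_cong[of _ _ card] Collect_cong) auto
    finally show ?thesis .
  qed
  thus ?thesis
    unfolding stat_31_2_def occ_31_2_eq_sum by (simp add: sum.atLeast1_atMost_eq)
qed

section \<open>The four patterns in terms of positions\<close>

lemma contains_pattern_4:
  "contains_pattern m \<sigma> [a, b, c, d] \<longleftrightarrow>
     (\<exists>i j k l. 1 \<le> i \<and> i < j \<and> j < k \<and> k < l \<and> l \<le> m \<and>
        (\<forall>x<4. \<forall>y<4. \<sigma> ([i, j, k, l] ! x) < \<sigma> ([i, j, k, l] ! y) \<longleftrightarrow> [a, b, c, d] ! x < [a, b, c, d] ! y))"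
    (is "_ \<longleftrightarrow> ?rhs")
proof
  have len: "length [a, b, c, d] = 4" by simp
  assume "contains_pattern m \<sigma> [a, b, c, d]"
  then obtain pos where pos: "strict_mono_on {..<4::nat} pos" "pos ` {..<4::nat} \<subseteq> {1..m}"
    and ord: "\<forall>x<4. \<forall>y<4. \<sigma> (pos x) < \<sigma> (pos y) \<longleftrightarrow> [a, b, c, d] ! x < [a, b, c, d] ! y"
    unfolding contains_pattern_def len by blast
  have "[pos 0, pos 1, pos 2, pos 3] ! x = pos x" if "x < 4" for x
    using that by (auto simp: less_Suc_eq eval_nat_numeral)
  moreover have "pos 0 < pos 1" "pos 1 < pos 2" "pos 2 < pos 3"
    by (rule strict_mono_onD[OF pos(1)]; simp)+
  moreover have "1 \<le> pos 0" "pos 3 \<le> m"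
    using pos(2) by (auto simp: image_subset_iff)
  ultimately show ?rhs
    using ord by (intro exI[of _ "pos 0"] exI[of _ "pos 1"] exI[of _ "pos 2"] exI[of _ "pos 3"]) simp
next
  assume ?rhs
  then obtain i j k l where ijkl: "1 \<le> i" "i < j" "j < k" "k < l" "l \<le> m"
    and ord: "\<forall>x<4. \<forall>y<4. \<sigma> ([i, j, k, l] ! x) < \<sigma> ([i, j, k, l] ! y) \<longleftrightarrow> [a, b, c, d] ! x < [a, b, c, d] ! y"
    by blast
  have "strict_mono_on {..<4} (\<lambda>x. [i, j, k, l] ! x)"
    using ijkl by (auto simp: strict_mono_on_def less_Suc_eq eval_nat_numeral)
  moreover have "(\<lambda>x. [i, j, k, l] ! x) ` {..<4} \<subseteq> {1..m}"
    using ijkl by (auto simp: less_Suc_eq eval_nat_numeral)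
  ultimately show "contains_pattern m \<sigma> [a, b, c, d]"
    unfolding contains_pattern_def using ord
    by (intro exI[of _ "\<lambda>x. [i, j, k, l] ! x"]) (simp add: numeral_eq_Suc)
qed

text \<open>Passes from letters to positions; injectivity turns \<open>b = d\<close> into
  \<open>k = l\<close>.\<close>

lemma avoiding_word_iff:
  assumes "\<sigma> permutes {1..m}"
  shows "avoiding {} (word m \<sigma>) \<longleftrightarrow>
    \<not> (\<exists>i j k l. 1 \<le> i \<and> i < j \<and> j < k \<and> k \<le> m \<and> j < l \<and> l \<le> m \<and> k \<noteq> l \<and>
        \<sigma> j < \<sigma> k \<and> \<sigma> k < \<sigma> i \<and> \<sigma> j < \<sigma> l)"
proof -
  have inj: "inj \<sigma>" using assms by (rule permutes_inj)
  have take: "set (take j (word m \<sigma>)) = \<sigma> ` {1..j}" if "j < m" for j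
    using that by (simp add: word_def take_map atLeastLessThanSuc_atLeastAtMost take_upt del: upt_Suc)
  have drop: "set (drop (Suc j) (word m \<sigma>)) = \<sigma> ` {Suc (Suc j)..m}" for j
    by (simp add: word_def drop_map atLeastLessThanSuc_atLeastAtMost del: upt_Suc)
  have step: "avoiding {} (word m \<sigma>) \<longleftrightarrow> (\<forall>j<m. \<forall>i\<in>{1..j}. \<forall>k\<in>{Suc (Suc j)..m}. \<forall>l\<in>{Suc (Suc j)..m}.
    \<sigma> (Suc j) < \<sigma> k \<and> \<sigma> k < \<sigma> i \<and> \<sigma> (Suc j) < \<sigma> l \<longrightarrow> k = l)"
    unfolding avoiding_iff length_word
  proof (intro all_cong)
    fix j assume "j < m"
    show "(\<forall>a\<in>{} \<union> set (take j (word m \<sigma>)). \<forall>b\<in>set (drop (Suc j) (word m \<sigma>)). \<forall>d\<in>set (drop (Suc j) (word m \<sigma>)).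
      word m \<sigma> ! j < b \<and> b < a \<and> word m \<sigma> ! j < d \<longrightarrow> b = d) \<longleftrightarrow>
      (\<forall>i\<in>{1..j}. \<forall>k\<in>{Suc (Suc j)..m}. \<forall>l\<in>{Suc (Suc j)..m}.
        \<sigma> (Suc j) < \<sigma> k \<and> \<sigma> k < \<sigma> i \<and> \<sigma> (Suc j) < \<sigma> l \<longrightarrow> k = l)"
      unfolding take[OF \<open>j < m\<close>] drop Un_empty_left ball_simps nth_word[OF \<open>j < m\<close>] inj_eq[OF inj]
      by (rule refl)
  qed
  show ?thesis
  proof
    assume av: "avoiding {} (word m \<sigma>)"
    have "k = l" if "1 \<le> i" "i < j" "j < k" "k \<le> m" "j < l" "l \<le> m"
      "\<sigma> j < \<sigma> k" "\<sigma> k < \<sigma> i" "\<sigma> j < \<sigma> l" for i j k l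
    proof -
      obtain j' where j: "j = Suc j'" using \<open>i < j\<close> by (cases j) auto
      show ?thesis
        using av[unfolded step, rule_format, of j' i k l] that by (simp add: j)
    qed
    thus "\<not> (\<exists>i j k l. 1 \<le> i \<and> i < j \<and> j < k \<and> k \<le> m \<and> j < l \<and> l \<le> m \<and> k \<noteq> l \<and>
        \<sigma> j < \<sigma> k \<and> \<sigma> k < \<sigma> i \<and> \<sigma> j < \<sigma> l)"
      by blast
  next
    assume none: "\<not> (\<exists>i j k l. 1 \<le> i \<and> i < j \<and> j < k \<and> k \<le> m \<and> j < l \<and> l \<le> m \<and> k \<noteq> l \<and>
        \<sigma> j < \<sigma> k \<and> \<sigma> k < \<sigma> i \<and> \<sigma> j < \<sigma> l)"
    show "avoiding {} (word m \<sigma>)"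
      unfolding step
    proof (intro allI ballI impI, rule ccontr)
      fix j i k l
      assume "j < m" "i \<in> {1..j}" "k \<in> {Suc (Suc j)..m}" "l \<in> {Suc (Suc j)..m}"
        "\<sigma> (Suc j) < \<sigma> k \<and> \<sigma> k < \<sigma> i \<and> \<sigma> (Suc j) < \<sigma> l" "k \<noteq> l"
      hence "1 \<le> i \<and> i < Suc j \<and> Suc j < k \<and> k \<le> m \<and> Suc j < l \<and> l \<le> m \<and> k \<noteq> l \<and>
        \<sigma> (Suc j) < \<sigma> k \<and> \<sigma> k < \<sigma> i \<and> \<sigma> (Suc j) < \<sigma> l"
        by auto
      thus False using none by blast
    qed
  qed
qed

text \<open>A chain of strict inequalities through all four values fixes every pairwise
  comparison.\<close>

lemma contains_pattern_chain:
  shows "contains_pattern m \<sigma> [3,1,2,4] \<longleftrightarrow> (\<exists>i j k l. 1 \<le> i \<and> i < j \<and> j < k \<and> k < l \<and> l \<le> m \<and>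
      \<sigma> j < \<sigma> k \<and> \<sigma> k < \<sigma> i \<and> \<sigma> i < \<sigma> l)"
    and "contains_pattern m \<sigma> [4,1,2,3] \<longleftrightarrow> (\<exists>i j k l. 1 \<le> i \<and> i < j \<and> j < k \<and> k < l \<and> l \<le> m \<and>
      \<sigma> j < \<sigma> k \<and> \<sigma> k < \<sigma> l \<and> \<sigma> l < \<sigma> i)"
    and "contains_pattern m \<sigma> [3,1,4,2] \<longleftrightarrow> (\<exists>i j k l. 1 \<le> i \<and> i < j \<and> j < k \<and> k < l \<and> l \<le> m \<and>
      \<sigma> j < \<sigma> l \<and> \<sigma> l < \<sigma> i \<and> \<sigma> i < \<sigma> k)"
    and "contains_pattern m \<sigma> [4,1,3,2] \<longleftrightarrow> (\<exists>i j k l. 1 \<le> i \<and> i < j \<and> j < k \<and> k < l \<and> l \<le> m \<and>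
      \<sigma> j < \<sigma> l \<and> \<sigma> l < \<sigma> k \<and> \<sigma> k < \<sigma> i)"
proof -
  have four: "(\<forall>x<4. Q x) \<longleftrightarrow> Q 0 \<and> Q 1 \<and> Q 2 \<and> Q 3" for Q :: "nat \<Rightarrow> bool"
    by (simp add: numeral_eq_Suc All_less_Suc conj_ac)
  have nth: "[i, j, k, l] ! 0 = i" "[i, j, k, l] ! 1 = j" "[i, j, k, l] ! 2 = k" "[i, j, k, l] ! 3 = l"
    for i j k l :: nat
    by simp_all
  show "contains_pattern m \<sigma> [3,1,2,4] \<longleftrightarrow> (\<exists>i j k l. 1 \<le> i \<and> i < j \<and> j < k \<and> k < l \<and> l \<le> m \<and>
      \<sigma> j < \<sigma> k \<and> \<sigma> k < \<sigma> i \<and> \<sigma> i < \<sigma> l)"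
    unfolding contains_pattern_4 four nth by (intro ex_cong1 conj_cong refl iffI) auto
  show "contains_pattern m \<sigma> [4,1,2,3] \<longleftrightarrow> (\<exists>i j k l. 1 \<le> i \<and> i < j \<and> j < k \<and> k < l \<and> l \<le> m \<and>
      \<sigma> j < \<sigma> k \<and> \<sigma> k < \<sigma> l \<and> \<sigma> l < \<sigma> i)"
    unfolding contains_pattern_4 four nth by (intro ex_cong1 conj_cong refl iffI) auto
  show "contains_pattern m \<sigma> [3,1,4,2] \<longleftrightarrow> (\<exists>i j k l. 1 \<le> i \<and> i < j \<and> j < k \<and> k < l \<and> l \<le> m \<and>
      \<sigma> j < \<sigma> l \<and> \<sigma> l < \<sigma> i \<and> \<sigma> i < \<sigma> k)"
    unfolding contains_pattern_4 four nth by (intro ex_cong1 conj_cong refl iffI) auto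
  show "contains_pattern m \<sigma> [4,1,3,2] \<longleftrightarrow> (\<exists>i j k l. 1 \<le> i \<and> i < j \<and> j < k \<and> k < l \<and> l \<le> m \<and>
      \<sigma> j < \<sigma> l \<and> \<sigma> l < \<sigma> k \<and> \<sigma> k < \<sigma> i)"
    unfolding contains_pattern_4 four nth by (intro ex_cong1 conj_cong refl iffI) auto
qed

text \<open>Of the six patterns of length four with 1 in second place, 2134 and 2143 have both last
  letters above the first. In the other four, the forbidden ones, one of these letters is the 2 of a
  312.\<close>

lemma avoiders_iff:
  assumes \<sigma>: "\<sigma> permutes {1..m}"
  shows "\<sigma> \<in> avoiders m {[3,1,2,4], [4,1,2,3], [3,1,4,2], [4,1,3,2]} \<longleftrightarrow> avoiding {} (word m \<sigma>)"
proof -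
  let ?C = "contains_pattern m \<sigma> [3,1,2,4] \<or> contains_pattern m \<sigma> [4,1,2,3] \<or>
      contains_pattern m \<sigma> [3,1,4,2] \<or> contains_pattern m \<sigma> [4,1,3,2]"
  have "?C" if ijkl: "1 \<le> i" "i < j" "j < k" "k \<le> m" "j < l" "l \<le> m" "k \<noteq> l"
      "\<sigma> j < \<sigma> k" "\<sigma> k < \<sigma> i" "\<sigma> j < \<sigma> l" for i j k l
  proof -
    have "\<sigma> l \<noteq> \<sigma> i" "\<sigma> l \<noteq> \<sigma> k"
      using ijkl inj_eq[OF permutes_inj[OF \<sigma>]] by auto
    \<comment> \<open>With the order of \<open>k\<close> and \<open>l\<close> there are six cases.
      If both letters are below the one at \<open>i\<close> they can exchange roles, so four
      patterns result.\<close>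
    hence "\<sigma> i < \<sigma> l \<or> \<sigma> l < \<sigma> i \<and> (\<sigma> k < \<sigma> l \<or> \<sigma> l < \<sigma> k)"
      by linarith
    moreover have "k < l \<or> l < k"
      using ijkl(7) by linarith
    ultimately show ?thesis
      unfolding contains_pattern_chain using ijkl by metis
  qed
  moreover have "\<exists>i j k l. 1 \<le> i \<and> i < j \<and> j < k \<and> k \<le> m \<and> j < l \<and> l \<le> m \<and> k \<noteq> l \<and>
        \<sigma> j < \<sigma> k \<and> \<sigma> k < \<sigma> i \<and> \<sigma> j < \<sigma> l" if ?C
  proof -
    \<comment> \<open>What the four patterns share. If only the letter at \<open>l\<close> is below
      the one at \<open>i\<close>, then \<open>k\<close> and \<open>l\<close> swap roles at the
      end.\<close>
    have "\<exists>i j k l. 1 \<le> i \<and> i < j \<and> j < k \<and> k < l \<and> l \<le> m \<and>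
        \<sigma> j < \<sigma> k \<and> \<sigma> j < \<sigma> l \<and> (\<sigma> k < \<sigma> i \<or> \<sigma> l < \<sigma> i)"
      using that unfolding contains_pattern_chain by (elim disjE ex_forward) auto
    then obtain i j k l where ijkl: "1 \<le> i" "i < j" "j < k" "k < l" "l \<le> m"
      "\<sigma> j < \<sigma> k" "\<sigma> j < \<sigma> l" "\<sigma> k < \<sigma> i \<or> \<sigma> l < \<sigma> i"
      by (elim exE conjE)
    have "j < l" "k \<le> m" "k \<noteq> l" "l \<noteq> k"
      using ijkl(3-5) by linarith+
    with ijkl show ?thesis by metis
  qed
  ultimately have "\<not> ?C \<longleftrightarrow> avoiding {} (word m \<sigma>)"
    unfolding avoiding_word_iff[OF \<sigma>] by (intro arg_cong[of _ _ Not] iffI; (elim exE conjE)?)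
  thus ?thesis
    unfolding avoiders_def using \<sigma> by simp
qed

lemma bij_betw_word: "bij_betw (word m) {\<sigma>. \<sigma> permutes {1..m}} {w. distinct w \<and> set w = {1..m}}"
  unfolding bij_betw_def
proof (intro conjI equalityI subsetI)
  show "inj_on (word m) {\<sigma>. \<sigma> permutes {1..m}}"
  proof (intro inj_onI ext)
    fix \<sigma> \<tau> x
    assume *: "\<sigma> \<in> {\<sigma>. \<sigma> permutes {1..m}}" "\<tau> \<in> {\<sigma>. \<sigma> permutes {1..m}}" "word m \<sigma> = word m \<tau>"
    show "\<sigma> x = \<tau> x"
    proof (cases "x \<in> {1..m}")
      case True
      thus ?thesis using *(3) by (simp add: word_def del: upt_Suc)
    next
      case False
      thus ?thesis using * by (simp add: permutes_not_in)
    qed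
  qed
next
  fix w assume "w \<in> word m ` {\<sigma>. \<sigma> permutes {1..m}}"
  then obtain \<sigma> where "w = word m \<sigma>" and \<sigma>: "\<sigma> permutes {1..m}" by auto
  moreover have "distinct (word m \<sigma>)"
    using permutes_inj_on[OF \<sigma>]
    by (simp add: word_def distinct_map atLeastLessThanSuc_atLeastAtMost del: upt_Suc)
  ultimately show "w \<in> {w. distinct w \<and> set w = {1..m}}"
    using set_word permutes_image[OF \<sigma>] by simp
next
  fix w assume "w \<in> {w. distinct w \<and> set w = {1..m}}"
  hence w: "distinct w" "set w = {1..m}" by auto
  hence len: "length w = m" using distinct_card[of w] by simp
  \<comment> \<open>The identity outside \<open>{1..m}\<close>, as \<open>permutes\<close> demands;
    \<open>x - 1\<close> passes from positions to list indices.\<close>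
  define \<sigma> where "\<sigma> x = (if x \<in> {1..m} then w ! (x - 1) else x)" for x
  have w_eq: "word m \<sigma> = w"
    by (intro nth_equalityI) (auto simp: len \<sigma>_def)
  have "bij_betw \<sigma> {1..m} {1..m}"
    unfolding bij_betw_def
  proof
    show "\<sigma> ` {1..m} = {1..m}"
      using w(2) set_word[of m \<sigma>] by (simp add: w_eq)
    show "inj_on \<sigma> {1..m}"
      using w(1) unfolding w_eq[symmetric]
      by (simp add: word_def distinct_map atLeastLessThanSuc_atLeastAtMost del: upt_Suc)
  qed
  hence "\<sigma> permutes {1..m}"
    by (rule bij_imp_permutes) (auto simp: \<sigma>_def)
  thus "w \<in> word m ` {\<sigma>. \<sigma> permutes {1..m}}"
    using w_eq by blast
qed

theorem theorem1p4:
  fixes p q t :: "'a::comm_ring_1" and n :: nat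
  shows "B_poly n p q t =
    (\<Sum>\<sigma>\<in>avoiders (n + 1) {[3,1,2,4], [4,1,2,3], [3,1,4,2], [4,1,3,2]}.
       p ^ stat_2_13 (n + 1) \<sigma> * q ^ stat_31_2 (n + 1) \<sigma> * t ^ des (n + 1) \<sigma>)"
proof -
  let ?A = "avoiders (n + 1) {[3,1,2,4], [4,1,2,3], [3,1,4,2], [4,1,3,2]}"
  have A: "?A = {\<sigma>. \<sigma> permutes {1..n + 1} \<and> avoiding {} (word (n + 1) \<sigma>)}"
    using avoiders_iff[of _ "n + 1"] by (auto simp: avoiders_def)
  have "word (n + 1) ` ?A = {w \<in> word (n + 1) ` {\<sigma>. \<sigma> permutes {1..n + 1}}. avoiding {} w}"
    unfolding A by blast
  also have "\<dots> = avoiding_words (n + 1)"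
    unfolding bij_betw_imp_surj_on[OF bij_betw_word] avoiding_words_def by simp
  finally have "word (n + 1) ` ?A = avoiding_words (n + 1)" .
  moreover have "inj_on (word (n + 1)) ?A"
    by (rule inj_on_subset[OF bij_betw_imp_inj_on[OF bij_betw_word]])
      (auto simp: avoiders_def)
  ultimately have bij: "bij_betw (word (n + 1)) ?A (avoiding_words (n + 1))"
    by (simp add: bij_betw_def)
  \<comment> \<open>The first inserted letter starts the path at height 0, so \<open>n + 1\<close>
    letters make \<open>n\<close> steps.\<close>
  have "B_poly n p q t = (\<Sum>w\<in>avoiding_words (n + 1). weight p q t w)"
    by (simp add: B_poly_eq_motzkin[of n p q t] sum_weight_avoiding_words)
  also have "\<dots> = (\<Sum>\<sigma>\<in>?A. weight p q t (word (n + 1) \<sigma>))"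
    by (rule sum.reindex_bij_betw[OF bij, symmetric])
  also have "\<dots> = (\<Sum>\<sigma>\<in>?A. p ^ stat_2_13 (n + 1) \<sigma> * q ^ stat_31_2 (n + 1) \<sigma> * t ^ des (n + 1) \<sigma>)"
    by (intro sum.cong refl) (simp add: avoiders_def weight_def stat_2_13_eq stat_31_2_eq des_eq_descents)
  finally show ?thesis .
qed

end
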